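(* Let $f:\mathbb{R}^n\to\mathbb{R}$ be differentiable with $L_f$-Lipschitz gradient and strongly convex with parameter $\mu_f>0$, let $g:\mathbb{R}^m\to(-\infty,+\infty]$ be proper, closed and convex ($\mu_g=0$), and let $A\in\mathbb{R}^{m\times n}$, $A\ne0$. Let $$t_0=\left\lceil 2\,\frac{L_f-\mu_f}{\mu_f}\right\rceil,$$ and run LDPD (defined in the context) with $y_0=y_1$ and $$\theta_t=1,\qquad \alpha_t=\frac{t+t_0}{t+t_0+1},\qquad 0<\tau\le\frac{\mu_f}{2\|A\|^2},\qquad \tau_t=(t+1)\tau,\qquad \eta_t=\frac{1}{L_f+\tau_t\|A\|^2}.$$ For $k\ge1$ define $$\tilde x_{k+1}=\frac{\sum_{t=1}^k(t+t_0+1)x_{t+1}}{\sum_{t=1}^k(t+t_0+1)},\qquad \tilde y_{k+1}=\frac{\sum_{t=1}^k(t+t_0+1)y_{t+1}}{\sum_{t=1}^k(t+t_0+1)},\qquad \tilde E_{k+1}=L(\tilde x_{k+1},y)-L(x,\tilde y_{k+1}).$$ Then for all $k\ge1$, $x\in\mathbb{R}^n$ and $y\in Y$, $$\tilde E_{k+1}\le\frac{t_0+2}{k(k+3+2t_0)}\left[\|x-x_1\|^2\left(L_f-\mu_f+2\tau\|A\|^2\right)+\frac{\|y-y_1\|^2}{2\tau}\right].$$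
   Context: Saddle point problem: $\min_x\max_y L(x,y)$ with $L(x,y)=f(x)+\langle Ax,y\rangle-g(y)$. Norms are Euclidean, and $\|A\|$ is the operator norm. Put $Y=\operatorname{dom} g=\{y\in\mathbb{R}^m: g(y)<+\infty\}$. A function $h$ is strongly convex with parameter $\mu\ge0$ if $h-\frac{\mu}{2}\|\cdot\|^2$ is convex. LDPD (linearized method): given $x_1\in\mathbb{R}^n$, $y_1\in Y$, parameters $\theta_t\in(0,1]$, $\alpha_t\in\mathbb{R}$, $\tau_t>0$, $\eta_t>0$, set $\bar x_1=x_1$, $\bar y_1=y_1$, $\hat y_1=y_1$, and for $t=1,2,\dots$ compute - $\hat x_t=(1-\theta_t)\bar x_t+\theta_t x_t$, - $x_{t+1}=\arg\min_{x}\|x-[x_t-\eta_t(\nabla f(\hat x_t)+A^T\hat y_t)]\|^2$, - $\bar x_{t+1}=(1-\theta_t)\bar x_t+\theta_t x_{t+1}$, - $y_{t+1}=\arg\min_y\left\{\frac{1}{2\tau_t}\|y-(y_t+\tau_tAx_{t+1})\|^2+g(y)\right\}$, - $\hat y_{t+1}=y_{t+1}+\alpha_{t+1}(y_{t+1}-y_t)$, - $\bar y_{t+1}=(1-\theta_t)\bar y_t+\theta_t y_{t+1}$. When $\theta_t=1$ for all $t$, one has $\hat x_t=x_t$, $\bar x_{t+1}=x_{t+1}$, $\bar y_{t+1}=y_{t+1}$. The convention $y_0=y_1$ makes $\hat y_1=y_1+\alpha_1(y_1-y_0)$ consistent with $\hat y_1=y_1$. *)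

theory Defs
  imports "HOL-Analysis.Analysis"
begin

text \<open>
  Functions into \<open>(-\<infinity>, +\<infinity>]\<close> are rendered as \<^typ>\<open>ereal\<close>-valued functions; the value
  \<open>-\<infinity>\<close> is excluded by \<open>proper_fun\<close>. Convexity and closedness are those of the epigraph in
  \<open>'a \<times> real\<close>. The library's \<^const>\<open>epigraph\<close> only covers real-valued functions.
\<close>

definition dom_fun :: "('a \<Rightarrow> ereal) \<Rightarrow> 'a set" where
  "dom_fun g = {y. g y < \<infinity>}"

definition epi_fun :: "('a \<Rightarrow> ereal) \<Rightarrow> ('a \<times> real) set" where
  "epi_fun g = {(y, r). g y \<le> ereal r}"

definition proper_fun :: "('a \<Rightarrow> ereal) \<Rightarrow> bool" where
  "proper_fun g \<longleftrightarrow> (\<forall>y. g y \<noteq> -\<infinity>) \<and> dom_fun g \<noteq> {}"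

definition closed_fun :: "('a::topological_space \<Rightarrow> ereal) \<Rightarrow> bool" where
  "closed_fun g \<longleftrightarrow> closed (epi_fun g)"

definition convex_fun :: "('a::real_vector \<Rightarrow> ereal) \<Rightarrow> bool" where
  "convex_fun g \<longleftrightarrow> convex (epi_fun g)"

definition strongly_convex :: "real \<Rightarrow> ('a::real_normed_vector \<Rightarrow> real) \<Rightarrow> bool" where
  "strongly_convex \<mu> h \<longleftrightarrow> \<mu> \<ge> 0 \<and> convex_on UNIV (\<lambda>x. h x - \<mu> / 2 * (norm x)\<^sup>2)"

definition opnorm :: "real ^ 'n ^ 'm \<Rightarrow> real" where
  "opnorm A = onorm (\<lambda>x. A *v x)"

definition lagr ::
    "(real ^ 'n \<Rightarrow> real) \<Rightarrow> (real ^ 'm \<Rightarrow> ereal) \<Rightarrow> real ^ 'n ^ 'm \<Rightarrow> real ^ 'n \<Rightarrow> real ^ 'm \<Rightarrow> ereal" where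
  "lagr f g A x y = ereal (f x + (A *v x) \<bullet> y) - g y"

text \<open>
  The sequences are produced by the linearized method (LDPD). Here \<open>f'\<close> is the gradient of \<open>f\<close>,
  \<open>xb\<close>, \<open>yb\<close> are the barred and \<open>xh\<close>, \<open>yh\<close> the hatted sequences. The iteration
  starts at index 1, so entries at index 0 are irrelevant. Both minimizers are unique (the objectives
  are strongly convex), hence the relational form of the arg min is no loss.
\<close>

definition LDPD ::
    "(real ^ 'n \<Rightarrow> real ^ 'n) \<Rightarrow> (real ^ 'm \<Rightarrow> ereal) \<Rightarrow> real ^ 'n ^ 'm
     \<Rightarrow> (nat \<Rightarrow> real) \<Rightarrow> (nat \<Rightarrow> real) \<Rightarrow> (nat \<Rightarrow> real) \<Rightarrow> (nat \<Rightarrow> real)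
     \<Rightarrow> (nat \<Rightarrow> real ^ 'n) \<Rightarrow> (nat \<Rightarrow> real ^ 'n) \<Rightarrow> (nat \<Rightarrow> real ^ 'n)
     \<Rightarrow> (nat \<Rightarrow> real ^ 'm) \<Rightarrow> (nat \<Rightarrow> real ^ 'm) \<Rightarrow> (nat \<Rightarrow> real ^ 'm) \<Rightarrow> bool" where
  "LDPD f' g A \<theta> \<alpha> \<tau> \<eta> x xb xh y yb yh \<longleftrightarrow>
     y 1 \<in> dom_fun g \<and> xb 1 = x 1 \<and> yb 1 = y 1 \<and> yh 1 = y 1 \<and>
     (\<forall>t\<ge>1.
        xh t = (1 - \<theta> t) *\<^sub>R xb t + \<theta> t *\<^sub>R x t \<and>
        is_arg_min (\<lambda>u. (norm (u - (x t - \<eta> t *\<^sub>R (f' (xh t) + transpose A *v yh t))))\<^sup>2)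
          (\<lambda>_. True) (x (t + 1)) \<and>
        xb (t + 1) = (1 - \<theta> t) *\<^sub>R xb t + \<theta> t *\<^sub>R x (t + 1) \<and>
        is_arg_min
          (\<lambda>v. ereal (1 / (2 * \<tau> t) * (norm (v - (y t + \<tau> t *\<^sub>R (A *v x (t + 1)))))\<^sup>2) + g v)
          (\<lambda>_. True) (y (t + 1)) \<and>
        yh (t + 1) = y (t + 1) + \<alpha> (t + 1) *\<^sub>R (y (t + 1) - y t) \<and>
        yb (t + 1) = (1 - \<theta> t) *\<^sub>R yb t + \<theta> t *\<^sub>R y (t + 1))"

end

theory Submission
  imports Defs
begin

text \<open>
  Write \<open>w t = t + t0 + 1\<close> for the averaging weights, \<open>z t = x (t + 1) - u\<close>, and let \<open>c\<close> be the average
  of the \<open>z t\<close>. One iteration is a gradient step in \<open>x\<close> and a proximal step in \<open>y\<close>. Each of them bounds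
  its part of the gap by a difference of squared distances, up to the coupling of \<open>A z\<close> with the
  extrapolation error of \<open>y\<close> (\<open>gradient_step_bound\<close>, \<open>prox_step_bound\<close>). After multiplication by
  \<open>w t\<close> the coupling telescopes, because \<open>\<alpha> (t + 1) = w t / w (t + 1)\<close>, and Young's inequality absorbs
  its remainder in the negative squares of the increments (\<open>weighted_gap_telescope\<close>).

  The squared distances to \<open>u\<close> do not telescope to a nonpositive remainder: with \<open>p t = 1 / \<eta> t\<close>, the
  coefficient \<open>w (t + 1) * (p (t + 1) - \<mu>) - w t * p t\<close> of \<open>(norm (z t))\<^sup>2 / 2\<close> can be positive,
  although it never exceeds \<open>\<tau> * (norm A)\<^sup>2 \<le> \<mu> / 2\<close>. Three quantities that a plain telescoping argument
  discards pay for this overshoot: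

  \<^item> strong convexity improves Jensen's inequality for the average by \<open>\<mu> / 2\<close> times the weighted
    variance of the \<open>z t\<close> (\<open>strong_Jensen\<close>);
  \<^item> the end of the telescope leaves \<open>- w k * L / 2 * (norm (z k))\<^sup>2\<close>;
  \<^item> since \<open>w t * \<tau>s t\<close> grows with \<open>t\<close>, Young's inequality is applied with room to spare, which leaves
    negative multiples of \<open>(norm (z (t + 1) - z t))\<^sup>2\<close>; the last of them is enough.

  If all \<open>z t\<close> stay close to \<open>c\<close>, then so does \<open>z k\<close>, and the second quantity is of order
  \<open>k * (norm c)\<^sup>2\<close>, like the total overshoot. If instead \<open>z k\<close> leaves \<open>c\<close>, then the first and the third
  are of that order. The inequality \<open>squares_absorbed\<close> makes this trade-off quantitative, with
  \<open>overshoot_absorbed\<close> as the form that fits the weights and step sizes of the method.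
\<close>

section \<open>Smooth and strongly convex functions\<close>

lemma GDERIV_along_line:
  fixes f :: "'a::real_inner \<Rightarrow> real"
  assumes "\<And>u. GDERIV f u :> f' u"
  shows "((\<lambda>s. f (u + s *\<^sub>R d)) has_real_derivative f' (u + s *\<^sub>R d) \<bullet> d) (at s)"
proof -
  have "(f has_derivative (\<lambda>h. h \<bullet> f' (u + s *\<^sub>R d))) (at (u + s *\<^sub>R d))"
    using assms by (simp add: gderiv_def)
  moreover have "((\<lambda>s. u + s *\<^sub>R d) has_derivative (\<lambda>h. h *\<^sub>R d)) (at s)"
    by (auto intro!: derivative_eq_intros)
  ultimately have "((\<lambda>s. f (u + s *\<^sub>R d)) has_derivative (\<lambda>h. (h *\<^sub>R d) \<bullet> f' (u + s *\<^sub>R d))) (at s)"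
    by (rule has_derivative_compose[rotated])
  thus ?thesis
    by (simp add: has_field_derivative_def inner_commute mult_commute_abs)
qed

lemma descent_lemma:
  fixes f :: "'a::real_inner \<Rightarrow> real"
  assumes grad: "\<And>u. GDERIV f u :> f' u" and lip: "L-lipschitz_on UNIV f'"
  shows "f v \<le> f u + f' u \<bullet> (v - u) + L / 2 * (norm (v - u))\<^sup>2"
proof -
  define d where "d = v - u"
  \<comment> \<open>\<open>f\<close> along the segment minus the nonconstant terms of the quadratic model: it decreases from \<open>f u\<close>.\<close>
  define \<phi> where "\<phi> s = f (u + s *\<^sub>R d) - s * (f' u \<bullet> d) - L / 2 * s\<^sup>2 * (norm d)\<^sup>2" for s
  have "\<phi> 0 \<ge> \<phi> 1"
  proof (rule DERIV_nonpos_imp_nonincreasing[where f = \<phi>])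
    fix s :: real assume s: "0 \<le> s" "s \<le> 1"
    have "(\<phi> has_real_derivative f' (u + s *\<^sub>R d) \<bullet> d - f' u \<bullet> d - L * s * (norm d)\<^sup>2) (at s)"
      unfolding \<phi>_def[abs_def]
      by (rule derivative_eq_intros GDERIV_along_line[OF grad] refl)+ (simp add: power2_eq_square)
    moreover have "f' (u + s *\<^sub>R d) \<bullet> d - f' u \<bullet> d \<le> L * s * (norm d)\<^sup>2"
    proof -
      have "f' (u + s *\<^sub>R d) \<bullet> d - f' u \<bullet> d = (f' (u + s *\<^sub>R d) - f' u) \<bullet> d"
        by (simp add: inner_diff_left)
      also have "\<dots> \<le> norm (f' (u + s *\<^sub>R d) - f' u) * norm d"
        by (rule norm_cauchy_schwarz)
      also have "\<dots> \<le> (L * norm (s *\<^sub>R d)) * norm d"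
        using lipschitz_onD[OF lip, of "u + s *\<^sub>R d" u]
        by (intro mult_right_mono) (auto simp: dist_norm)
      also have "\<dots> = L * s * (norm d)\<^sup>2"
        using s by (simp add: power2_eq_square)
      finally show ?thesis .
    qed
    ultimately show "\<exists>D. (\<phi> has_real_derivative D) (at s) \<and> D \<le> 0" by force
  qed simp
  thus ?thesis by (simp add: \<phi>_def d_def)
qed

text \<open>
  Subtracting \<open>\<mu> / 2 * (norm x)\<^sup>2\<close> leaves a convex function, whose tangent bound along the line through
  \<open>u\<close> and \<open>v\<close> becomes the quadratic minorant once the square is added back.
\<close>
lemma strongly_convex_above_tangent:
  fixes f :: "'a::real_inner \<Rightarrow> real"
  assumes grad: "\<And>u. GDERIV f u :> f' u" and sc: "strongly_convex \<mu> f"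
  shows "f v \<ge> f u + f' u \<bullet> (v - u) + \<mu> / 2 * (norm (v - u))\<^sup>2"
proof -
  define d where "d = v - u"
  define h where "h x = f x - \<mu> / 2 * (norm x)\<^sup>2" for x
  have h: "convex_on UNIV h"
    using sc by (simp add: strongly_convex_def h_def[abs_def])
  have "convex_on UNIV (\<lambda>s::real. h (u + s *\<^sub>R d))"
  proof (rule convex_onI)
    fix t x y :: real assume "0 < t" "t < 1"
    moreover have "u + ((1 - t) *\<^sub>R x + t *\<^sub>R y) *\<^sub>R d = (1 - t) *\<^sub>R (u + x *\<^sub>R d) + t *\<^sub>R (u + y *\<^sub>R d)"
      by (simp add: algebra_simps)
    ultimately show "h (u + ((1 - t) *\<^sub>R x + t *\<^sub>R y) *\<^sub>R d)
        \<le> (1 - t) * h (u + x *\<^sub>R d) + t * h (u + y *\<^sub>R d)"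
      using convex_onD[OF h, of t] by simp
  qed simp
  moreover have "GDERIV h x :> f' x - \<mu> *\<^sub>R x" for x
  proof -
    have "(h has_derivative (\<lambda>k. k \<bullet> f' x - \<mu> / 2 * (2 * (k \<bullet> x)))) (at x)"
      using grad[of x] unfolding gderiv_def h_def power2_norm_eq_inner
      by (auto intro!: derivative_eq_intros simp: inner_commute)
    thus ?thesis by (simp add: gderiv_def inner_diff_right)
  qed
  from GDERIV_along_line[OF this, of u d 0]
  have "((\<lambda>s. h (u + s *\<^sub>R d)) has_real_derivative (f' u - \<mu> *\<^sub>R u) \<bullet> d) (at 0)" by simp
  ultimately have "h (u + 1 *\<^sub>R d) - h (u + 0 *\<^sub>R d) \<ge> ((f' u - \<mu> *\<^sub>R u) \<bullet> d) * (1 - 0)"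
    by (intro convex_on_imp_above_tangent[where A = UNIV]) auto
  hence "h v - h u \<ge> (f' u - \<mu> *\<^sub>R u) \<bullet> (v - u)" by (simp add: d_def)
  thus ?thesis
    by (simp add: h_def power2_norm_eq_inner inner_simps inner_commute field_simps)
qed

text \<open>
  A unit step is enough to compare the quadratic majorant with the quadratic minorant. In a space of
  dimension zero there is no such step and every \<open>\<mu>\<close> would do, hence the Euclidean space.
\<close>
lemma strong_convexity_le_Lipschitz:
  fixes f :: "'a::euclidean_space \<Rightarrow> real"
  assumes grad: "\<And>u. GDERIV f u :> f' u" and lip: "L-lipschitz_on UNIV f'"
    and sc: "strongly_convex \<mu> f"
  shows "\<mu> \<le> L"
proof -
  obtain b :: 'a where "b \<in> Basis" using nonempty_Basis by blast
  hence "norm b = 1" by simp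
  thus ?thesis
    using descent_lemma[OF grad lip, of b 0] strongly_convex_above_tangent[OF grad sc, of 0 b] by simp
qed

text \<open>
  The minorant at the average \<open>c\<close> is summed over the points: its linear term cancels, and its quadratic
  term leaves the weighted variance, which is what the convex case loses.
\<close>
lemma strong_Jensen:
  fixes f :: "'a::real_inner \<Rightarrow> real"
  assumes grad: "\<And>u. GDERIV f u :> f' u" and sc: "strongly_convex \<mu> f"
    and W: "(\<Sum>i\<in>I. w i) = W" "W > 0" and w: "\<And>i. i \<in> I \<Longrightarrow> w i \<ge> 0"
    and c: "c = (\<Sum>i\<in>I. w i *\<^sub>R x i) /\<^sub>R W"
  shows "W * f c + \<mu> / 2 * (\<Sum>i\<in>I. w i * (norm (x i - c))\<^sup>2) \<le> (\<Sum>i\<in>I. w i * f (x i))"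
proof -
  have Wc: "(\<Sum>i\<in>I. w i *\<^sub>R x i) = W *\<^sub>R c" using W(2) by (simp add: c)
  have "(\<Sum>i\<in>I. w i * (f' c \<bullet> (x i - c))) = f' c \<bullet> ((\<Sum>i\<in>I. w i *\<^sub>R x i) - (\<Sum>i\<in>I. w i) *\<^sub>R c)"
    by (simp add: inner_sum_right inner_diff_right right_diff_distrib sum_subtractf scaleR_sum_left
          sum_distrib_right)
  also have "\<dots> = 0" by (simp add: Wc W(1))
  finally have lin: "(\<Sum>i\<in>I. w i * (f' c \<bullet> (x i - c))) = 0" .
  have "W * f c + \<mu> / 2 * (\<Sum>i\<in>I. w i * (norm (x i - c))\<^sup>2)
      = (\<Sum>i\<in>I. w i * (f c + f' c \<bullet> (x i - c) + \<mu> / 2 * (norm (x i - c))\<^sup>2))"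
    using lin by (simp add: W(1)[symmetric] distrib_left sum.distrib sum_distrib_left sum_distrib_right mult_ac)
  also have "\<dots> \<le> (\<Sum>i\<in>I. w i * f (x i))"
    by (intro sum_mono mult_left_mono w strongly_convex_above_tangent[OF grad sc])
  finally show ?thesis .
qed

section \<open>Proximal steps for extended-valued convex functions\<close>

lemma convex_fun_Jensen:
  fixes g :: "'a::real_vector \<Rightarrow> ereal"
  assumes g: "proper_fun g" "convex_fun g" and I: "finite I"
    and w: "\<And>i. i \<in> I \<Longrightarrow> w i \<ge> 0" "sum w I = 1" and y: "\<And>i. i \<in> I \<Longrightarrow> y i \<in> dom_fun g"
  shows "g (\<Sum>i\<in>I. w i *\<^sub>R y i) \<le> ereal (\<Sum>i\<in>I. w i * real_of_ereal (g (y i)))"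
proof -
  have "(\<Sum>i\<in>I. w i *\<^sub>R (y i, real_of_ereal (g (y i)))) \<in> epi_fun g"
  proof (rule convex_sum)
    show "convex (epi_fun g)" using g(2) by (simp add: convex_fun_def)
    fix i assume "i \<in> I"
    hence "g (y i) < \<infinity>" "g (y i) \<noteq> -\<infinity>" using y g(1) by (auto simp: dom_fun_def proper_fun_def)
    thus "(y i, real_of_ereal (g (y i))) \<in> epi_fun g" by (cases "g (y i)") (auto simp: epi_fun_def)
  qed (use I w in auto)
  moreover have "(\<Sum>i\<in>I. w i *\<^sub>R (y i, real_of_ereal (g (y i))))
      = (\<Sum>i\<in>I. w i *\<^sub>R y i, \<Sum>i\<in>I. w i * real_of_ereal (g (y i)))"
    by (simp add: prod_eq_iff fst_sum snd_sum)
  ultimately show ?thesis by (simp add: epi_fun_def)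
qed

lemma dom_fun_ereal:
  assumes "proper_fun g" "v \<in> dom_fun g"
  shows "g v = ereal (real_of_ereal (g v))"
  using assms by (cases "g v") (auto simp: proper_fun_def dom_fun_def)

lemma prox_minimizer_in_dom:
  assumes g: "proper_fun g"
    and min: "is_arg_min (\<lambda>v. ereal (q v) + g v) (\<lambda>_. True) z"
  shows "z \<in> dom_fun g"
proof -
  obtain v where v: "v \<in> dom_fun g" using g by (auto simp: proper_fun_def)
  have "ereal (q z) + g z \<le> ereal (q v) + g v" using min by (auto simp: is_arg_min_def not_less)
  also have "\<dots> < \<infinity>" using v by (simp add: dom_fun_def)
  finally show ?thesis by (cases "g z") (auto simp: dom_fun_def)
qed

text \<open>
  Moving from the minimizer \<open>z\<close> a fraction \<open>s\<close> of the way towards \<open>v\<close> cannot decrease the objective;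
  convexity of \<open>g\<close> bounds the change by \<open>s * (D + s * K)\<close>, and dividing by \<open>s\<close> and letting \<open>s\<close> tend
  to zero gives the first-order condition \<open>D \<ge> 0\<close>.
\<close>
lemma prox_variational_inequality:
  fixes g :: "'a::real_inner \<Rightarrow> ereal"
  assumes g: "proper_fun g" "convex_fun g" and \<tau>: "\<tau> > 0" and v: "v \<in> dom_fun g"
    and min: "is_arg_min (\<lambda>v. ereal (1 / (2 * \<tau>) * (norm (v - p))\<^sup>2) + g v) (\<lambda>_. True) z"
  shows "real_of_ereal (g z) + (1 / \<tau>) * ((p - z) \<bullet> (v - z)) \<le> real_of_ereal (g v)"
proof -
  define G where "G u = real_of_ereal (g u)" for u
  have z: "z \<in> dom_fun g" using prox_minimizer_in_dom[OF g(1) min] .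
  define D where "D = G v - G z - (1 / \<tau>) * ((p - z) \<bullet> (v - z))"
  define K where "K = (norm (v - z))\<^sup>2 / (2 * \<tau>)"
  have quad: "0 \<le> D + s * K" if s: "0 < s" "s < 1" for s
  proof -
    define m where "m = z + s *\<^sub>R (v - z)"
    \<comment> \<open>Jensen for two points, indexed by the Booleans.\<close>
    have "g (\<Sum>i\<in>UNIV. (if i then s else 1 - s) *\<^sub>R (if i then v else z))
        \<le> ereal (\<Sum>i\<in>UNIV. (if i then s else 1 - s) * real_of_ereal (g (if i then v else z)))"
      by (rule convex_fun_Jensen[OF g]) (use s v z in \<open>auto simp: UNIV_bool\<close>)
    hence m: "g m \<le> ereal ((1 - s) * G z + s * G v)"
      by (simp add: UNIV_bool m_def G_def algebra_simps)
    have "ereal (1 / (2 * \<tau>) * (norm (z - p))\<^sup>2) + ereal (G z) \<le> ereal (1 / (2 * \<tau>) * (norm (m - p))\<^sup>2) + g m"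
      using min dom_fun_ereal[OF g(1) z] by (auto simp: is_arg_min_def not_less G_def)
    also have "\<dots> \<le> ereal (1 / (2 * \<tau>) * (norm (m - p))\<^sup>2) + ereal ((1 - s) * G z + s * G v)"
      using m by (intro add_left_mono)
    finally have "1 / (2 * \<tau>) * (norm (z - p))\<^sup>2 + G z
        \<le> 1 / (2 * \<tau>) * (norm (m - p))\<^sup>2 + ((1 - s) * G z + s * G v)" by simp
    moreover
    have "(norm (m - p))\<^sup>2
        = (norm (z - p))\<^sup>2 - 2 * s * ((p - z) \<bullet> (v - z)) + s\<^sup>2 * (norm (v - z))\<^sup>2"
      unfolding m_def power2_norm_eq_inner by (simp add: inner_simps inner_commute power2_eq_square algebra_simps)
    hence "1 / (2 * \<tau>) * (norm (m - p))\<^sup>2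
        = 1 / (2 * \<tau>) * (norm (z - p))\<^sup>2 - s * ((1 / \<tau>) * ((p - z) \<bullet> (v - z))) + s * (s * K)"
      using \<tau> by (simp add: K_def field_simps power2_eq_square)
    ultimately have "0 \<le> s * (D + s * K)" by (simp add: D_def algebra_simps)
    thus ?thesis using s by (simp add: zero_le_mult_iff)
  qed
  have "((\<lambda>s. D + s * K) \<longlongrightarrow> D + 0 * K) (at_right 0)" by (intro tendsto_intros)
  moreover have "\<forall>\<^sub>F s in at_right (0::real). 0 \<le> D + s * K"
    using eventually_at_right_less[of "0::real"] eventually_at_right_field[of "\<lambda>s. s < 1" "0::real"]
    by (auto intro!: quad elim!: eventually_elim2 simp: eventually_at_right_field intro: exI[of _ 1])
  ultimately have "0 \<le> D + 0 * K" by (rule tendsto_lowerbound) simp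
  thus ?thesis by (simp add: D_def G_def)
qed

section \<open>One iteration\<close>

lemma three_point:
  fixes a b c :: "'a::real_inner"
  shows "2 * ((a - b) \<bullet> (b - c)) = (norm (a - c))\<^sup>2 - (norm (b - c))\<^sup>2 - (norm (b - a))\<^sup>2"
  unfolding power2_norm_eq_inner by (simp add: inner_simps inner_commute)

text \<open>
  Here \<open>p\<close> is the inverse step size. The value at \<open>x'\<close> is compared with the value at \<open>u\<close> by passing
  through the point \<open>x\<close> at which the gradient is taken: the majorant leads from \<open>x\<close> to \<open>x'\<close> and the minorant
  from \<open>x\<close> to \<open>u\<close>. The step equation turns the remaining inner product into squared distances.
\<close>
lemma gradient_step_bound:
  fixes f :: "'a::real_inner \<Rightarrow> real"
  assumes grad: "\<And>u. GDERIV f u :> f' u" and lip: "L-lipschitz_on UNIV f'"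
    and sc: "strongly_convex \<mu> f" and p: "p > 0"
    and step: "x' = x - (1 / p) *\<^sub>R (f' x + q)"
  shows "f x' - f u + (x' - u) \<bullet> q
      \<le> (p - \<mu>) / 2 * (norm (x - u))\<^sup>2 - p / 2 * (norm (x' - u))\<^sup>2 - (p - L) / 2 * (norm (x' - x))\<^sup>2"
proof -
  have "f' x + q = p *\<^sub>R (x - x')" using p by (simp add: step)
  hence "(f' x + q) \<bullet> (x' - u) = p / 2 * (2 * ((x - x') \<bullet> (x' - u)))" by simp
  hence "f' x \<bullet> (x' - u) + (x' - u) \<bullet> q
      = p / 2 * ((norm (x - u))\<^sup>2 - (norm (x' - u))\<^sup>2 - (norm (x' - x))\<^sup>2)"
    unfolding three_point by (simp add: inner_simps inner_commute)
  moreover have "f' x \<bullet> (x' - x) - f' x \<bullet> (u - x) = f' x \<bullet> (x' - u)"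
    by (simp add: inner_simps)
  ultimately show ?thesis
    using descent_lemma[OF grad lip, of x' x] strongly_convex_above_tangent[OF grad sc, of x u]
    by (simp add: norm_minus_commute[of u x] algebra_simps diff_divide_distrib)
qed

lemma prox_step_bound:
  fixes g :: "'a::real_inner \<Rightarrow> ereal"
  assumes g: "proper_fun g" "convex_fun g" and \<tau>: "\<tau> > 0" and v: "v \<in> dom_fun g"
    and min: "is_arg_min (\<lambda>v. ereal (1 / (2 * \<tau>) * (norm (v - (y + \<tau> *\<^sub>R b)))\<^sup>2) + g v) (\<lambda>_. True) y'"
  shows "real_of_ereal (g y') - real_of_ereal (g v) - b \<bullet> (y' - v)
      \<le> 1 / (2 * \<tau>) * ((norm (y - v))\<^sup>2 - (norm (y' - v))\<^sup>2 - (norm (y' - y))\<^sup>2)"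
proof -
  have "(1 / \<tau>) * ((y + \<tau> *\<^sub>R b - y') \<bullet> (v - y')) = - b \<bullet> (y' - v) - 1 / (2 * \<tau>) * (2 * ((y - y') \<bullet> (y' - v)))"
    using \<tau> by (simp add: inner_simps field_simps)
  thus ?thesis
    using prox_variational_inequality[OF g \<tau> v min] unfolding three_point by simp
qed


section \<open>Telescoping the weighted gaps\<close>

lemma Young_operator:
  fixes A :: "'a::real_normed_vector \<Rightarrow> 'b::real_inner"
  assumes A: "norm (A z) \<le> M * norm z" and r: "r > 0"
  shows "A z \<bullet> d \<le> r * M\<^sup>2 / 2 * (norm z)\<^sup>2 + 1 / (2 * r) * (norm d)\<^sup>2"
proof -
  have "0 \<le> 1 / (2 * r) * (r * norm (A z) - norm d)\<^sup>2" using r by simp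
  hence "norm (A z) * norm d \<le> r / 2 * (norm (A z))\<^sup>2 + 1 / (2 * r) * (norm d)\<^sup>2"
    using r by (simp add: field_simps power2_eq_square)
  moreover have "(norm (A z))\<^sup>2 \<le> M\<^sup>2 * (norm z)\<^sup>2"
    using power_mono[OF A, of 2] by (simp add: power_mult_distrib)
  hence "r / 2 * (norm (A z))\<^sup>2 \<le> r / 2 * (M\<^sup>2 * (norm z)\<^sup>2)" using r by (intro mult_left_mono) auto
  ultimately show ?thesis using norm_cauchy_schwarz[of "A z" d] by simp
qed

text \<open>
  The relation between \<open>w\<close> and \<open>\<alpha>\<close> makes \<open>w t\<close> times the coupling of \<open>A (x (t + 1) - u)\<close> with the
  extrapolation error a difference of consecutive terms \<open>w t * (A (x (t + 1) - u) \<bullet> (y (t + 1) - y t))\<close>,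
  up to an error that pairs the new increment of \<open>x\<close> with the old increment of \<open>y\<close>. Young's inequality
  with parameter \<open>r t\<close> (not \<open>r (t + 1)\<close>) exactly uses up the square of the old \<open>y\<close> increment and only a part
  of the square of the new \<open>x\<close> increment; the part that is left is the last sum. The sum before it
  collects the coefficients by which the squared distances to \<open>u\<close> fail to cancel, whatever their sign.
\<close>
lemma weighted_gap_telescope:
  fixes A :: "'a::real_inner \<Rightarrow> 'b::real_inner" and x :: "nat \<Rightarrow> 'a" and y :: "nat \<Rightarrow> 'b"
    and w r p \<alpha> gap :: "nat \<Rightarrow> real"
  assumes A: "linear A" "\<And>z. norm (A z) \<le> M * norm z"
    and w: "\<And>t. t \<ge> 1 \<Longrightarrow> w t > 0" and r: "\<And>t. t \<ge> 1 \<Longrightarrow> r t > 0"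
    and y0: "y 0 = y 1"
    and \<alpha>: "\<And>t. t \<ge> 1 \<Longrightarrow> w (t + 1) * \<alpha> (t + 1) = w t"
    and mono: "\<And>t. t \<ge> 1 \<Longrightarrow> w (t + 1) / r (t + 1) \<le> w t / r t"
    and gap: "\<And>t. t \<ge> 1 \<Longrightarrow> gap t \<le>
        (p t - \<mu>) / 2 * (norm (x t - u))\<^sup>2 - p t / 2 * (norm (x (t + 1) - u))\<^sup>2
        - r t * M\<^sup>2 / 2 * (norm (x (t + 1) - x t))\<^sup>2
        + 1 / (2 * r t) * ((norm (y t - v))\<^sup>2 - (norm (y (t + 1) - v))\<^sup>2 - (norm (y (t + 1) - y t))\<^sup>2)
        + A (x (t + 1) - u) \<bullet> ((y (t + 1) - y t) - \<alpha> t *\<^sub>R (y t - y (t - 1)))"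
    and k: "k \<ge> 1"
  shows "(\<Sum>t=1..k. w t * gap t) \<le>
      w 1 * (p 1 - \<mu>) / 2 * (norm (x 1 - u))\<^sup>2 + w 1 / (2 * r 1) * (norm (y 1 - v))\<^sup>2
      - w k * p k / 2 * (norm (x (k + 1) - u))\<^sup>2 - w k / (2 * r k) * (norm (y (k + 1) - v))\<^sup>2
      - w k / (2 * r k) * (norm (y (k + 1) - y k))\<^sup>2 + w k * (A (x (k + 1) - u) \<bullet> (y (k + 1) - y k))
      + (\<Sum>t=1..<k. (w (t + 1) * (p (t + 1) - \<mu>) - w t * p t) / 2 * (norm (x (t + 1) - u))\<^sup>2)
      - (\<Sum>t=1..<k. (w (t + 1) * r (t + 1) - w t * r t) * M\<^sup>2 / 2 * (norm (x (t + 2) - x (t + 1)))\<^sup>2)"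
  using k
proof (induction k rule: dec_induct)
  case base
  have "w 1 * gap 1 \<le> w 1 * ((p 1 - \<mu>) / 2 * (norm (x 1 - u))\<^sup>2 - p 1 / 2 * (norm (x (1 + 1) - u))\<^sup>2
        - r 1 * M\<^sup>2 / 2 * (norm (x (1 + 1) - x 1))\<^sup>2
        + 1 / (2 * r 1) * ((norm (y 1 - v))\<^sup>2 - (norm (y (1 + 1) - v))\<^sup>2 - (norm (y (1 + 1) - y 1))\<^sup>2)
        + A (x (1 + 1) - u) \<bullet> ((y (1 + 1) - y 1) - \<alpha> 1 *\<^sub>R (y 1 - y (1 - 1))))"
    using w[of 1] by (intro mult_left_mono gap) auto
  \<comment> \<open>As \<open>y 0 = y 1\<close>, the first coupling has no extrapolation part, and this square has nothing to absorb.\<close>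
  moreover have "0 \<le> w 1 * (r 1 * M\<^sup>2 / 2 * (norm (x (1 + 1) - x 1))\<^sup>2)"
    using w[of 1] r[of 1] by simp
  ultimately show ?case using y0 by (simp add: algebra_simps diff_divide_distrib)
next
  case (step k)
  define z where "z = x (k + 1) - u"
  define dx where "dx = x (k + 2) - x (k + 1)"
  define dy where "dy = y (k + 1) - y k"
  define dy' where "dy' = y (k + 2) - y (k + 1)"
  define w' where "w' = w (k + 1)"
  define r' where "r' = r (k + 1)"
  define p' where "p' = p (k + 1)"
  define b where "b = (norm (y (k + 1) - v))\<^sup>2"
  define b' where "b' = (norm (y (k + 2) - v))\<^sup>2"
  define Z' where "Z' = (norm (x (k + 2) - u))\<^sup>2"
  have k: "k \<ge> 1" "w k > 0" "r k > 0" using step(1) w r by auto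
  have z': "A (x (k + 2) - u) = A z + A dx"
    unfolding z_def dx_def linear_add[OF A(1), symmetric] by simp
  have "gap (k + 1) \<le> (p' - \<mu>) / 2 * (norm z)\<^sup>2 - p' / 2 * Z' - r' * M\<^sup>2 / 2 * (norm dx)\<^sup>2
      + 1 / (2 * r') * (b - b' - (norm dy')\<^sup>2)
      + A (x (k + 2) - u) \<bullet> (dy' - \<alpha> (k + 1) *\<^sub>R dy)"
    using gap[of "k + 1"] by (simp add: z_def dx_def dy_def dy'_def r'_def p'_def b_def b'_def Z'_def)
  hence "w' * gap (k + 1) \<le> w' * ((p' - \<mu>) / 2 * (norm z)\<^sup>2 - p' / 2 * Z' - r' * M\<^sup>2 / 2 * (norm dx)\<^sup>2
      + 1 / (2 * r') * (b - b' - (norm dy')\<^sup>2)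
      + A (x (k + 2) - u) \<bullet> (dy' - \<alpha> (k + 1) *\<^sub>R dy))"
    using w[of "k + 1"] by (intro mult_left_mono) (auto simp: w'_def)
  also have "\<dots> = w' * (p' - \<mu>) / 2 * (norm z)\<^sup>2 - w' * p' / 2 * Z' - w' * r' * M\<^sup>2 / 2 * (norm dx)\<^sup>2
      + w' / (2 * r') * b - w' / (2 * r') * b' - w' / (2 * r') * (norm dy')\<^sup>2
      + w' * (A (x (k + 2) - u) \<bullet> dy') - (w' * \<alpha> (k + 1)) * (A (x (k + 2) - u) \<bullet> dy)"
    by (simp add: inner_diff_right algebra_simps diff_divide_distrib)
  also have "w' * \<alpha> (k + 1) = w k" using \<alpha>[OF k(1)] by (simp add: w'_def)
  also have "w k * (A (x (k + 2) - u) \<bullet> dy) = w k * (A z \<bullet> dy) + w k * (A dx \<bullet> dy)"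
    by (simp only: z' inner_add_left distrib_left)
  finally have 1: "w' * gap (k + 1) \<le> w' * (p' - \<mu>) / 2 * (norm z)\<^sup>2 - w' * p' / 2 * Z' - w' * r' * M\<^sup>2 / 2 * (norm dx)\<^sup>2
      + w' / (2 * r') * b - w' / (2 * r') * b' - w' / (2 * r') * (norm dy')\<^sup>2
      + w' * (A (x (k + 2) - u) \<bullet> dy') - (w k * (A z \<bullet> dy) + w k * (A dx \<bullet> dy))" .
  have "A dx \<bullet> (- dy) \<le> r k * M\<^sup>2 / 2 * (norm dx)\<^sup>2 + 1 / (2 * r k) * (norm (- dy))\<^sup>2"
    by (rule Young_operator[OF A(2) k(3)])
  from mult_left_mono[OF this, of "w k"]
  have 2: "- (w k * (A dx \<bullet> dy)) \<le> w k * r k * M\<^sup>2 / 2 * (norm dx)\<^sup>2 + w k / (2 * r k) * (norm dy)\<^sup>2"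
    using k(2) by (simp add: algebra_simps)
  have 3: "w' / (2 * r') * b \<le> w k / (2 * r k) * b"
    using mult_right_mono[OF mono[OF k(1)], of "b / 2"] by (simp add: b_def w'_def r'_def)
  have IH: "(\<Sum>t=1..k. w t * gap t) \<le>
      w 1 * (p 1 - \<mu>) / 2 * (norm (x 1 - u))\<^sup>2 + w 1 / (2 * r 1) * (norm (y 1 - v))\<^sup>2
      - w k * p k / 2 * (norm z)\<^sup>2 - w k / (2 * r k) * b
      - w k / (2 * r k) * (norm dy)\<^sup>2 + w k * (A z \<bullet> dy)
      + (\<Sum>t=1..<k. (w (t + 1) * (p (t + 1) - \<mu>) - w t * p t) / 2 * (norm (x (t + 1) - u))\<^sup>2)
      - (\<Sum>t=1..<k. (w (t + 1) * r (t + 1) - w t * r t) * M\<^sup>2 / 2 * (norm (x (t + 2) - x (t + 1)))\<^sup>2)"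
    using step.IH by (simp add: z_def dy_def b_def)
  have s1: "(\<Sum>t=1..<Suc k. (w (t + 1) * (p (t + 1) - \<mu>) - w t * p t) / 2 * (norm (x (t + 1) - u))\<^sup>2)
    = (\<Sum>t=1..<k. (w (t + 1) * (p (t + 1) - \<mu>) - w t * p t) / 2 * (norm (x (t + 1) - u))\<^sup>2)
      + (w' * (p' - \<mu>) / 2 * (norm z)\<^sup>2 - w k * p k / 2 * (norm z)\<^sup>2)"
    using k(1) by (simp add: w'_def p'_def z_def diff_divide_distrib left_diff_distrib)
  have s2: "(\<Sum>t=1..<Suc k. (w (t + 1) * r (t + 1) - w t * r t) * M\<^sup>2 / 2 * (norm (x (t + 2) - x (t + 1)))\<^sup>2)
    = (\<Sum>t=1..<k. (w (t + 1) * r (t + 1) - w t * r t) * M\<^sup>2 / 2 * (norm (x (t + 2) - x (t + 1)))\<^sup>2)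
      + (w' * r' * M\<^sup>2 / 2 * (norm dx)\<^sup>2 - w k * r k * M\<^sup>2 / 2 * (norm dx)\<^sup>2)"
    using k(1) by (simp add: w'_def r'_def dx_def diff_divide_distrib left_diff_distrib)
  have s3: "(\<Sum>t=1..Suc k. w t * gap t) = (\<Sum>t=1..k. w t * gap t) + w' * gap (k + 1)"
    by (simp add: w'_def)
  have e: "Suc k = k + 1" "k + 1 + 1 = k + 2" by simp_all
  show ?case
    unfolding s1 s2 s3 unfolding e w'_def[symmetric] r'_def[symmetric] p'_def[symmetric]
      Z'_def[symmetric] b'_def[symmetric] dy'_def[symmetric]
    using IH 1 2 3 by linarith
qed

section \<open>Paying for the overshoot of the telescope\<close>

text \<open>
  This is the end of the trade-off, with \<open>a\<close> the last and \<open>b\<close> the last but one member of the sequence. Without the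
  last square the minimum of the right-hand side over \<open>a\<close> and \<open>b\<close> is about \<open>k / 2 * (norm c)\<^sup>2\<close>, and
  the factors summed in \<open>sum_shift_factors_le\<close> exceed this by a logarithm of \<open>k\<close>. The last square raises
  the leading constant to \<open>3 / 5\<close>, reached at three and four fifths of \<open>c\<close> by \<open>a\<close> and \<open>b\<close>.
  The constant \<open>17 / 15\<close> is \<open>3 / 5 * 2 - 1 / 15\<close>, so that the left factor is
  the bound of \<open>sum_shift_factors_le\<close> at \<open>k - 2\<close>.
\<close>
lemma last_block_bound:
  fixes a b c :: "'a::real_inner" and k :: real
  assumes "k \<ge> 2"
  shows "(3 / 5 * k - 17 / 15) * (norm c)\<^sup>2 + 1 / 2 * (norm b)\<^sup>2
    \<le> k * (norm (b - c))\<^sup>2 + (k + 1) * (norm (a - c))\<^sup>2 + (k + 1) * (norm a)\<^sup>2 + (k + 1 / 2) * (norm (a - b))\<^sup>2"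
proof -
  define e where "e = b - c"
  define q where "q = a - c"
  have ab: "b = e + c" "a = q + c" by (simp_all add: e_def q_def)
  \<comment> \<open>The difference of the two sides is affine in \<open>k\<close>. First its slope, then its value at \<open>k = 2\<close>, as sums
    of squares obtained by completing the square in \<open>e\<close> and then in \<open>q\<close>.\<close>
  have "0 \<le> (norm (e - (1 / 2) *\<^sub>R q))\<^sup>2" "0 \<le> (norm (q + (2 / 5) *\<^sub>R c))\<^sup>2" by simp_all
  hence "0 \<le> (k - 2) * (2 * (norm (e - (1 / 2) *\<^sub>R q))\<^sup>2 + 5 / 2 * (norm (q + (2 / 5) *\<^sub>R c))\<^sup>2)"
    using assms by simp
  moreover have "0 \<le> 4 * (norm (e - (1 / 8) *\<^sub>R (c + 5 *\<^sub>R q)))\<^sup>2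
      + 111 / 16 * (norm (q + (43 / 111) *\<^sub>R c))\<^sup>2 + (569 / 240 - 1849 / 1776) * (norm c)\<^sup>2" by simp
  ultimately show ?thesis
    unfolding ab power2_norm_eq_inner
    by (simp add: inner_simps inner_commute[of e c] inner_commute[of q c] inner_commute[of q e]
         algebra_simps add_divide_distrib diff_divide_distrib)
qed

text \<open>
  The factor of \<open>(norm c)\<^sup>2\<close> is optimal. It exceeds \<open>1 / 2\<close> only by about \<open>1 / (4 * w)\<close>, so
  for large weights the square costs hardly more than half of \<open>(norm c)\<^sup>2\<close>.
\<close>
lemma sq_le_shifted:
  fixes z c :: "'a::real_inner"
  assumes w: "w > 1 / 2"
  shows "1 / 2 * (norm z)\<^sup>2 \<le> w * (norm (z - c))\<^sup>2 + w / (2 * w - 1) * (norm c)\<^sup>2"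
proof -
  define s where "s = 2 * w - 1"
  have s: "s > 0" "w = (s + 1) / 2" using w by (auto simp: s_def)
  have "0 \<le> (norm (s *\<^sub>R (z - c) - c))\<^sup>2 / (2 * s)" using s by simp
  also have "\<dots> = w * (norm (z - c))\<^sup>2 + w / s * (norm c)\<^sup>2 - 1 / 2 * (norm z)\<^sup>2"
    using s(1) unfolding s(2) power2_norm_eq_inner
    by (simp add: inner_simps inner_commute field_simps power2_eq_square)
  finally show ?thesis by (simp add: s_def)
qed

text \<open>
  The first factor is \<open>2 / 3\<close> and all others are at most \<open>3 / 5\<close>, with equality for the second;
  \<open>1 / 15\<close> is the excess of the first.
\<close>
lemma sum_shift_factors_le:
  "(\<Sum>t=1..k. (real t + 1) / (2 * (real t + 1) - 1)) \<le> 3 / 5 * real k + 1 / 15"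
proof (induction k)
  case (Suc k)
  show ?case
  proof (cases "k = 0")
    case False
    hence "(real (Suc k) + 1) / (2 * (real (Suc k) + 1) - 1) \<le> 3 / 5" by (simp add: field_simps)
    from add_mono[OF Suc.IH this]
    show ?thesis by (simp add: algebra_simps add_divide_distrib)
  qed simp
qed simp

text \<open>
  The normalized form of the trade-off. All but the last two members are
  compared with \<open>c\<close> one at a time; what this costs in \<open>(norm c)\<^sup>2\<close> is paid by the last two.
\<close>
lemma squares_absorbed:
  fixes z :: "nat \<Rightarrow> 'a::real_inner"
  assumes k: "k \<ge> 2"
  shows "1 / 2 * (\<Sum>t=1..<k. (norm (z t))\<^sup>2)
    \<le> (\<Sum>t=1..k. (real t + 1) * (norm (z t - c))\<^sup>2) + (real k + 1) * (norm (z k))\<^sup>2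
      + (real k + 1 / 2) * (norm (z k - z (k - 1)))\<^sup>2"
proof -
  have "1 / 2 * (\<Sum>t=1..k-2. (norm (z t))\<^sup>2)
      \<le> (\<Sum>t=1..k-2. (real t + 1) * (norm (z t - c))\<^sup>2
          + (real t + 1) / (2 * (real t + 1) - 1) * (norm c)\<^sup>2)"
    unfolding sum_distrib_left by (intro sum_mono sq_le_shifted) simp
  also have "\<dots> = (\<Sum>t=1..k-2. (real t + 1) * (norm (z t - c))\<^sup>2)
      + (\<Sum>t=1..k-2. (real t + 1) / (2 * (real t + 1) - 1)) * (norm c)\<^sup>2"
    by (simp add: sum.distrib sum_distrib_right)
  also have "\<dots> \<le> (\<Sum>t=1..k-2. (real t + 1) * (norm (z t - c))\<^sup>2)
      + (3 / 5 * real k - 17 / 15) * (norm c)\<^sup>2"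
    using sum_shift_factors_le[of "k - 2"] k
    by (intro add_left_mono mult_right_mono) (simp_all add: of_nat_diff diff_divide_distrib)
  finally have 1: "1 / 2 * (\<Sum>t=1..k-2. (norm (z t))\<^sup>2) \<le> \<dots>" .
  obtain j where j: "k = Suc (Suc j)" using k by (metis add_2_eq_Suc le_Suc_ex)
  have 2: "(\<Sum>t=1..<k. (norm (z t))\<^sup>2) = (\<Sum>t=1..k-2. (norm (z t))\<^sup>2) + (norm (z (k - 1)))\<^sup>2"
    "(\<Sum>t=1..k. (real t + 1) * (norm (z t - c))\<^sup>2) = (\<Sum>t=1..k-2. (real t + 1) * (norm (z t - c))\<^sup>2)
      + real k * (norm (z (k - 1) - c))\<^sup>2 + (real k + 1) * (norm (z k - c))\<^sup>2"
    by (simp_all add: j atLeastLessThanSuc_atLeastAtMost add.commute)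
  show ?thesis
    unfolding 2 using 1 last_block_bound[of "real k" c "z (k - 1)" "z k"] k by simp
qed


text \<open>
  With \<open>l = 2 * \<tau> * m / \<mu>\<close> each coefficient on the left is at most \<open>l * \<mu> / 2\<close>, and the growth of
  \<open>w t * r t\<close> is proportional to \<open>l\<close> as well. Hence the claim is, up to the factor \<open>l * \<mu> / 2\<close>, the
  normalized inequality \<open>squares_absorbed\<close>: a shift \<open>s > 0\<close> and an \<open>L > \<mu>\<close> only enlarge the
  weights on the right, and \<open>l \<le> 1\<close> admits the terms that do not carry the factor \<open>l\<close>.
\<close>
lemma overshoot_absorbed:
  fixes z :: "nat \<Rightarrow> 'a::real_inner" and w r p :: "nat \<Rightarrow> real"
  assumes \<mu>: "\<mu> > 0" "\<mu> \<le> L" and s: "s \<ge> 0" "L - \<mu> \<le> s * \<mu> / 2"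
    and \<tau>: "0 \<le> \<tau> * m" "\<tau> * m \<le> \<mu> / 2" and k: "k \<ge> 1"
  defines "w \<equiv> \<lambda>t. real t + s + 1" and "r \<equiv> \<lambda>t. (real t + 1) * \<tau>" and "p \<equiv> \<lambda>t. L + (real t + 1) * \<tau> * m"
  shows "(\<Sum>t=1..<k. (w (t + 1) * (p (t + 1) - \<mu>) - w t * p t) / 2 * (norm (z t))\<^sup>2)
    \<le> \<mu> / 2 * (\<Sum>t=1..k. w t * (norm (z t - c))\<^sup>2) + w k * L / 2 * (norm (z k))\<^sup>2
      + (\<Sum>t=1..<k. (w (t + 1) * r (t + 1) - w t * r t) * m / 2 * (norm (z (t + 1) - z t))\<^sup>2)"
    (is "?V \<le> _ * ?J + ?F + ?S")
proof (cases "k = 1")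
  case True
  thus ?thesis using \<mu> s by (simp add: w_def)
next
  case False
  hence k2: "k \<ge> 2" using k by simp
  define l where "l = 2 * (\<tau> * m) / \<mu>"
  have l: "0 \<le> l" "l \<le> 1" using \<tau> \<mu> by (auto simp: l_def field_simps)
  have m: "\<tau> * m = l * \<mu> / 2" using \<mu> by (simp add: l_def)
  have coeff: "w (t + 1) * (p (t + 1) - \<mu>) - w t * p t \<le> l * \<mu> / 2" for t
  proof -
    have "w (t + 1) * (p (t + 1) - \<mu>) - w t * p t
        = (L - \<mu>) - (real t + s + 1) * \<mu> + (2 * real t + s + 3) * (\<tau> * m)"
      by (simp add: w_def p_def algebra_simps)
    also have "\<dots> \<le> s * \<mu> / 2 - (real t + s + 1) * \<mu> + (2 * real t + s + 3) * (l * \<mu> / 2)"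
      unfolding m[symmetric] using s by simp
    also have "\<dots> = l * \<mu> / 2 - (1 - l) * \<mu> * (2 * real t + s + 2) / 2" by (simp add: field_simps)
    also have "\<dots> \<le> l * \<mu> / 2" using l \<mu> s by simp
    finally show ?thesis .
  qed
  have "?V \<le> (\<Sum>t=1..<k. l * \<mu> / 2 / 2 * (norm (z t))\<^sup>2)"
    by (intro sum_mono mult_right_mono divide_right_mono coeff) auto
  also have "\<dots> = l * (\<mu> / 2) * (1 / 2 * (\<Sum>t=1..<k. (norm (z t))\<^sup>2))"
    by (simp add: sum_distrib_left)
  also have "\<dots> \<le> l * (\<mu> / 2) * ((\<Sum>t=1..k. (real t + 1) * (norm (z t - c))\<^sup>2)
      + (real k + 1) * (norm (z k))\<^sup>2 + (real k + 1 / 2) * (norm (z k - z (k - 1)))\<^sup>2)"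
    using l \<mu> by (intro mult_left_mono squares_absorbed k2) auto
  also have "\<dots> = l * (\<mu> / 2 * ((\<Sum>t=1..k. (real t + 1) * (norm (z t - c))\<^sup>2)
      + (real k + 1) * (norm (z k))\<^sup>2)) + l * \<mu> / 2 * (real k + 1 / 2) * (norm (z k - z (k - 1)))\<^sup>2"
    by (simp add: algebra_simps)
  also have "\<dots> \<le> (\<mu> / 2 * ?J + ?F) + ?S"
  proof (rule add_mono)
    have J: "(\<Sum>t=1..k. (real t + 1) * (norm (z t - c))\<^sup>2) \<le> ?J"
      using s by (intro sum_mono mult_right_mono) (auto simp: w_def)
    have "(real k + 1) * \<mu> \<le> w k * L" using \<mu> s by (intro mult_mono) (auto simp: w_def)
    hence F: "\<mu> / 2 * ((real k + 1) * (norm (z k))\<^sup>2) \<le> ?F"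
      using mult_right_mono[of "(real k + 1) * \<mu>" "w k * L" "(norm (z k))\<^sup>2 / 2"] by (simp add: mult_ac)
    have "l * (\<mu> / 2 * ((\<Sum>t=1..k. (real t + 1) * (norm (z t - c))\<^sup>2) + (real k + 1) * (norm (z k))\<^sup>2))
        \<le> 1 * (\<mu> / 2 * ((\<Sum>t=1..k. (real t + 1) * (norm (z t - c))\<^sup>2) + (real k + 1) * (norm (z k))\<^sup>2))"
      using l \<mu> by (intro mult_right_mono mult_nonneg_nonneg add_nonneg_nonneg sum_nonneg) auto
    also have "\<dots> \<le> \<mu> / 2 * ?J + ?F"
      using add_mono[OF mult_left_mono[OF J, of "\<mu> / 2"] F] \<mu> by (simp add: distrib_left)
    finally show "l * (\<mu> / 2 * ((\<Sum>t=1..k. (real t + 1) * (norm (z t - c))\<^sup>2) + (real k + 1) * (norm (z k))\<^sup>2))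
        \<le> \<mu> / 2 * ?J + ?F" .
  next
    have growth: "(w (t + 1) * r (t + 1) - w t * r t) * m = (2 * real t + s + 3) * (l * \<mu> / 2)" for t
      unfolding m[symmetric] by (simp add: w_def r_def algebra_simps)
    have "l * \<mu> / 2 * (real k + 1 / 2) * (norm (z k - z (k - 1)))\<^sup>2
        \<le> (w (k - 1 + 1) * r (k - 1 + 1) - w (k - 1) * r (k - 1)) * m / 2 * (norm (z (k - 1 + 1) - z (k - 1)))\<^sup>2"
    proof -
      have "(w (k - 1 + 1) * r (k - 1 + 1) - w (k - 1) * r (k - 1)) * m / 2
          = l * \<mu> / 2 * (real k + 1 / 2) + l * \<mu> * s / 4"
        unfolding growth using k2 by (simp add: of_nat_diff field_simps)
      thus ?thesis using k2 l \<mu> s by (simp add: mult_right_mono)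
    qed
    also have "\<dots> \<le> ?S"
    proof (rule member_le_sum[where f = "\<lambda>t. (w (t + 1) * r (t + 1) - w t * r t) * m / 2 * (norm (z (t + 1) - z t))\<^sup>2"])
      fix t
      show "0 \<le> (w (t + 1) * r (t + 1) - w t * r t) * m / 2 * (norm (z (t + 1) - z t))\<^sup>2"
        unfolding growth using l \<mu> s by simp
    qed (use k2 in auto)
    finally show "l * \<mu> / 2 * (real k + 1 / 2) * (norm (z k - z (k - 1)))\<^sup>2 \<le> ?S" .
  qed
  finally show ?thesis by simp
qed

section \<open>The ergodic gap of the linearized method\<close>

lemma sum_weights: "(\<Sum>t=1..k. real t + s + 1) = real k * (real k + 3 + 2 * s) / 2"
  by (induction k) (simp_all add: field_simps)



theorem theorem3p3:
  fixes f :: "real ^ 'n \<Rightarrow> real" and f' :: "real ^ 'n \<Rightarrow> real ^ 'n"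
    and g :: "real ^ 'm \<Rightarrow> ereal" and A :: "real ^ 'n ^ 'm"
    and Lf \<mu>f \<tau> :: real and t0 :: int
    and \<theta> \<alpha> \<tau>s \<eta> :: "nat \<Rightarrow> real"
    and x xb xh xt :: "nat \<Rightarrow> real ^ 'n" and y yb yh yt :: "nat \<Rightarrow> real ^ 'm"
    and E :: "nat \<Rightarrow> real ^ 'n \<Rightarrow> real ^ 'm \<Rightarrow> ereal"
  assumes f_grad: "\<And>u. GDERIV f u :> f' u"
    and f_smooth: "Lf-lipschitz_on UNIV f'"
    and f_sc: "strongly_convex \<mu>f f" and \<mu>f_pos: "\<mu>f > 0"
    and g: "proper_fun g" "closed_fun g" "convex_fun g"
    and A_nz: "A \<noteq> 0"
    and t0: "t0 = \<lceil>2 * ((Lf - \<mu>f) / \<mu>f)\<rceil>"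
    and run: "LDPD f' g A \<theta> \<alpha> \<tau>s \<eta> x xb xh y yb yh"
    and y0: "y 0 = y 1"
    and \<theta>: "\<And>t. t \<ge> 1 \<Longrightarrow> \<theta> t = 1"
    and \<alpha>: "\<And>t. t \<ge> 1 \<Longrightarrow> \<alpha> t = (real t + of_int t0) / (real t + of_int t0 + 1)"
    and \<tau>: "0 < \<tau>" "\<tau> \<le> \<mu>f / (2 * (opnorm A)\<^sup>2)"
    and \<tau>s: "\<And>t. t \<ge> 1 \<Longrightarrow> \<tau>s t = (real t + 1) * \<tau>"
    and \<eta>: "\<And>t. t \<ge> 1 \<Longrightarrow> \<eta> t = 1 / (Lf + \<tau>s t * (opnorm A)\<^sup>2)"
    and xt: "\<And>k. k \<ge> 1 \<Longrightarrow> xt (k + 1) =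
          (\<Sum>t=1..k. (real t + of_int t0 + 1) *\<^sub>R x (t + 1)) /\<^sub>R (\<Sum>t=1..k. real t + of_int t0 + 1)"
    and yt: "\<And>k. k \<ge> 1 \<Longrightarrow> yt (k + 1) =
          (\<Sum>t=1..k. (real t + of_int t0 + 1) *\<^sub>R y (t + 1)) /\<^sub>R (\<Sum>t=1..k. real t + of_int t0 + 1)"
    and E: "\<And>k u v. k \<ge> 1 \<Longrightarrow> E (k + 1) u v = lagr f g A (xt (k + 1)) v - lagr f g A u (yt (k + 1))"
  shows "\<forall>k\<ge>1. \<forall>u. \<forall>v\<in>dom_fun g.
           E (k + 1) u v \<le> ereal ((of_int t0 + 2) / (real k * (real k + 3 + 2 * of_int t0)) *
             ((norm (u - x 1))\<^sup>2 * (Lf - \<mu>f + 2 * \<tau> * (opnorm A)\<^sup>2) + (norm (v - y 1))\<^sup>2 / (2 * \<tau>)))"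
proof (intro allI impI ballI)
  fix k :: nat and u :: "real ^ 'n" and v :: "real ^ 'm"
  assume k: "k \<ge> 1" and v: "v \<in> dom_fun g"
  define s where "s = real_of_int t0"
  define w where "w t = real t + s + 1" for t
  define r where "r t = (real t + 1) * \<tau>" for t
  define M where "M = opnorm A"
  define p where "p t = Lf + (real t + 1) * \<tau> * M\<^sup>2" for t
  define G where "G a = real_of_ereal (g a)" for a
  define gap where "gap t = f (x (t + 1)) + (A *v x (t + 1)) \<bullet> v - G v
      - (f u + (A *v u) \<bullet> y (t + 1) - G (y (t + 1)))" for t
  define c where "c = xt (k + 1)"
  define d where "d = yt (k + 1)"
  define W where "W = real k * (real k + 3 + 2 * s) / 2"

  have \<mu>L: "\<mu>f \<le> Lf" using strong_convexity_le_Lipschitz[OF f_grad f_smooth f_sc] .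
  have s_ge: "2 * ((Lf - \<mu>f) / \<mu>f) \<le> s" by (simp add: s_def t0)
  have s: "s \<ge> 0" using s_ge \<mu>L \<mu>f_pos by (smt (verit) divide_nonneg_pos)
  have Ls: "Lf - \<mu>f \<le> s * \<mu>f / 2" using s_ge \<mu>f_pos by (simp add: field_simps)
  have w: "w t > 0" for t using s by (simp add: w_def)
  have r: "r t > 0" for t using \<tau> by (simp add: r_def)
  have p: "p t > 0" for t
    unfolding p_def using \<mu>L \<mu>f_pos \<tau>(1) by (intro add_pos_nonneg mult_nonneg_nonneg) auto
  have A: "linear ((*v) A)" "norm (A *v z) \<le> M * norm z" for z
    using onorm[OF matrix_vector_mul_bounded_linear, of A z] by (simp_all add: M_def opnorm_def)
  have \<tau>M: "\<tau> * M\<^sup>2 \<le> \<mu>f / 2"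
  proof (cases "M = 0")
    case False
    hence "M\<^sup>2 > 0" by simp
    thus ?thesis using \<tau>(2) by (simp add: M_def[symmetric] field_simps)
  qed (use \<mu>f_pos in simp)

  have run':
    "xh t = (1 - \<theta> t) *\<^sub>R xb t + \<theta> t *\<^sub>R x t"
    "is_arg_min (\<lambda>u. (norm (u - (x t - \<eta> t *\<^sub>R (f' (xh t) + transpose A *v yh t))))\<^sup>2) (\<lambda>_. True) (x (t + 1))"
    "is_arg_min (\<lambda>v. ereal (1 / (2 * \<tau>s t) * (norm (v - (y t + \<tau>s t *\<^sub>R (A *v x (t + 1)))))\<^sup>2) + g v)
      (\<lambda>_. True) (y (t + 1))"
    "yh (t + 1) = y (t + 1) + \<alpha> (t + 1) *\<^sub>R (y (t + 1) - y t)" if "t \<ge> 1" for t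
    using run that unfolding LDPD_def by blast+
  have yh: "yh t = y t + \<alpha> t *\<^sub>R (y t - y (t - 1))" if "t \<ge> 1" for t
  proof (cases "t = 1")
    case True
    thus ?thesis using y0 run by (simp add: LDPD_def)
  next
    case False
    thus ?thesis using run'(4)[of "t - 1"] that by simp
  qed
  have x_step: "x (t + 1) = x t - (1 / p t) *\<^sub>R (f' (x t) + transpose A *v yh t)" if "t \<ge> 1" for t
  proof -
    have "xh t = x t" using run'(1)[OF that] \<theta>[OF that] by simp
    moreover have "is_arg_min (\<lambda>u. (norm (u - a))\<^sup>2) (\<lambda>_. True) b \<Longrightarrow> b = a" for a b :: "real ^ 'n"
      by (auto simp: is_arg_min_def dest!: spec[of _ a])
    ultimately show ?thesis
      using run'(2)[OF that] by (simp add: \<eta>[OF that] \<tau>s[OF that] p_def M_def)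
  qed
  have y_dom: "y (t + 1) \<in> dom_fun g" if "t \<ge> 1" for t
    using prox_minimizer_in_dom[OF g(1) run'(3)[OF that]] .

  have gap: "gap t \<le> (p t - \<mu>f) / 2 * (norm (x t - u))\<^sup>2 - p t / 2 * (norm (x (t + 1) - u))\<^sup>2
      - r t * M\<^sup>2 / 2 * (norm (x (t + 1) - x t))\<^sup>2
      + 1 / (2 * r t) * ((norm (y t - v))\<^sup>2 - (norm (y (t + 1) - v))\<^sup>2 - (norm (y (t + 1) - y t))\<^sup>2)
      + (A *v (x (t + 1) - u)) \<bullet> ((y (t + 1) - y t) - \<alpha> t *\<^sub>R (y t - y (t - 1)))" if t: "t \<ge> 1" for t
  proof -
    have r\<tau>: "\<tau>s t = r t" using \<tau>s[OF t] by (simp add: r_def)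
    have pL: "p t - Lf = r t * M\<^sup>2" by (simp add: p_def r_def)
    have "(x (t + 1) - u) \<bullet> (transpose A *v yh t) = (A *v (x (t + 1) - u)) \<bullet> yh t"
      by (metis dot_lmul_matrix inner_commute transpose_matrix_vector)
    moreover have "f (x (t + 1)) - f u + (x (t + 1) - u) \<bullet> (transpose A *v yh t)
        \<le> (p t - \<mu>f) / 2 * (norm (x t - u))\<^sup>2 - p t / 2 * (norm (x (t + 1) - u))\<^sup>2
          - r t * M\<^sup>2 / 2 * (norm (x (t + 1) - x t))\<^sup>2"
      using gradient_step_bound[OF f_grad f_smooth f_sc p x_step[OF t], of u] unfolding pL .
    moreover have "G (y (t + 1)) - G v - (A *v x (t + 1)) \<bullet> (y (t + 1) - v)
        \<le> 1 / (2 * r t) * ((norm (y t - v))\<^sup>2 - (norm (y (t + 1) - v))\<^sup>2 - (norm (y (t + 1) - y t))\<^sup>2)"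
      using prox_step_bound[OF g(1,3) r[of t] v] run'(3)[OF t] unfolding r\<tau> G_def by blast
    moreover have "gap t = (f (x (t + 1)) - f u + (A *v (x (t + 1) - u)) \<bullet> yh t)
        + (G (y (t + 1)) - G v - (A *v x (t + 1)) \<bullet> (y (t + 1) - v))
        + (A *v (x (t + 1) - u)) \<bullet> ((y (t + 1) - y t) - \<alpha> t *\<^sub>R (y t - y (t - 1)))"
      unfolding gap_def yh[OF t] matrix_vector_mult_diff_distrib
      by (simp add: inner_simps algebra_simps)
    ultimately show ?thesis by linarith
  qed

  have w\<alpha>: "w (t + 1) * \<alpha> (t + 1) = w t" if "t \<ge> 1" for t
    using \<alpha>[of "t + 1"] s by (simp add: w_def s_def[symmetric])
  \<comment> \<open>The dual distances telescope since \<open>w t / \<tau>s t\<close> decreases.\<close>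
  have wr: "w (t + 1) / r (t + 1) \<le> w t / r t" for t
  proof -
    have "w t / r t = (1 + s / (real t + 1)) / \<tau>" for t
      using \<tau>(1) by (simp add: w_def r_def field_simps)
    moreover have "s / (real (t + 1) + 1) \<le> s / (real t + 1)" using s by (intro divide_left_mono) auto
    ultimately show ?thesis using \<tau>(1) by (simp add: divide_right_mono)
  qed
  define V where "V = (\<Sum>t=1..<k. (w (t + 1) * (p (t + 1) - \<mu>f) - w t * p t) / 2 * (norm (x (t + 1) - u))\<^sup>2)"
  define S where "S = (\<Sum>t=1..<k. (w (t + 1) * r (t + 1) - w t * r t) * M\<^sup>2 / 2 * (norm (x (t + 2) - x (t + 1)))\<^sup>2)"
  define J where "J = (\<Sum>t=1..k. w t * (norm (x (t + 1) - c))\<^sup>2)"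
  have tele: "(\<Sum>t=1..k. w t * gap t) \<le>
      w 1 * (p 1 - \<mu>f) / 2 * (norm (x 1 - u))\<^sup>2 + w 1 / (2 * r 1) * (norm (y 1 - v))\<^sup>2
      - w k * p k / 2 * (norm (x (k + 1) - u))\<^sup>2 - w k / (2 * r k) * (norm (y (k + 1) - v))\<^sup>2
      - w k / (2 * r k) * (norm (y (k + 1) - y k))\<^sup>2 + w k * ((A *v (x (k + 1) - u)) \<bullet> (y (k + 1) - y k))
      + V - S"
    unfolding V_def S_def
    by (rule weighted_gap_telescope[OF A w r y0 w\<alpha> wr gap k])
  have cross: "w k * ((A *v (x (k + 1) - u)) \<bullet> (y (k + 1) - y k))
      \<le> w k * (r k * M\<^sup>2 / 2 * (norm (x (k + 1) - u))\<^sup>2 + 1 / (2 * r k) * (norm (y (k + 1) - y k))\<^sup>2)"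
    using less_imp_le[OF w[of k]] by (intro mult_left_mono Young_operator[OF A(2) r])
  \<comment> \<open>Of \<open>p k\<close>, the part \<open>r k * M\<^sup>2\<close> is spent on the final coupling; \<open>Lf\<close> is left for the overshoot.\<close>
  have pk: "p k = Lf + r k * M\<^sup>2" by (simp add: p_def r_def)
  \<comment> \<open>The variance does not change under the shift by \<open>u\<close>.\<close>
  have VJ: "V \<le> \<mu>f / 2 * J + w k * Lf / 2 * (norm (x (k + 1) - u))\<^sup>2 + S"
  proof -
    have "x (t + 1) - u - (c - u) = x (t + 1) - c" "x (t + 1 + 1) - u - (x (t + 1) - u) = x (t + 2) - x (t + 1)" for t
      by simp_all
    thus ?thesis
      using overshoot_absorbed[OF \<mu>f_pos \<mu>L s Ls _ \<tau>M k, of "\<lambda>t. x (t + 1) - u" "c - u"] \<tau>(1)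
      unfolding V_def J_def S_def w_def r_def p_def by simp
  qed
  have "w k / (2 * r k) * (norm (y (k + 1) - v))\<^sup>2 \<ge> 0" using w[of k] r[of k] by simp
  hence main: "(\<Sum>t=1..k. w t * gap t)
      \<le> w 1 * (p 1 - \<mu>f) / 2 * (norm (x 1 - u))\<^sup>2 + w 1 / (2 * r 1) * (norm (y 1 - v))\<^sup>2 + \<mu>f / 2 * J"
    using tele cross VJ unfolding pk by (simp add: distrib_left distrib_right add_divide_distrib)

  have W: "(\<Sum>t=1..k. w t) = W" unfolding w_def W_def by (rule sum_weights)
  have W0: "W > 0" using k s by (simp add: W_def)
  have c: "c = (\<Sum>t=1..k. w t *\<^sub>R x (t + 1)) /\<^sub>R W" and d: "d = (\<Sum>t=1..k. w t *\<^sub>R y (t + 1)) /\<^sub>R W"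
    using xt[OF k] yt[OF k] by (simp_all add: c_def d_def W[symmetric] w_def s_def)
  have Wc: "W *\<^sub>R c = (\<Sum>t=1..k. w t *\<^sub>R x (t + 1))" and Wd: "W *\<^sub>R d = (\<Sum>t=1..k. w t *\<^sub>R y (t + 1))"
    using W0 by (simp_all add: c d)
  have fc: "W * f c + \<mu>f / 2 * J \<le> (\<Sum>t=1..k. w t * f (x (t + 1)))"
    unfolding J_def by (rule strong_Jensen[OF f_grad f_sc W W0 less_imp_le[OF w] c])
  have "g d \<le> ereal (\<Sum>t=1..k. (w t / W) * G (y (t + 1)))"
  proof -
    have "g (\<Sum>t=1..k. (w t / W) *\<^sub>R y (t + 1)) \<le> ereal (\<Sum>t=1..k. (w t / W) * real_of_ereal (g (y (t + 1))))"
      using w W0 W y_dom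
      by (intro convex_fun_Jensen g) (auto simp: less_imp_le sum_divide_distrib[symmetric])
    moreover have "(\<Sum>t=1..k. (w t / W) *\<^sub>R y (t + 1)) = d"
      unfolding d scaleR_sum_right by (simp add: divide_inverse mult.commute)
    ultimately show ?thesis by (simp add: G_def)
  qed
  moreover have "g d \<noteq> -\<infinity>" using g(1) by (simp add: proper_fun_def)
  ultimately obtain \<gamma> where \<gamma>: "g d = ereal \<gamma>" "\<gamma> \<le> (\<Sum>t=1..k. (w t / W) * G (y (t + 1)))"
    by (cases "g d") auto
  have W\<gamma>: "W * \<gamma> \<le> (\<Sum>t=1..k. w t * G (y (t + 1)))"
    using mult_left_mono[OF \<gamma>(2), of W] W0 by (simp add: sum_distrib_left)
  have Ac: "W * ((A *v c) \<bullet> v) = (\<Sum>t=1..k. w t * ((A *v x (t + 1)) \<bullet> v))"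
  proof -
    have "W * ((A *v c) \<bullet> v) = (A *v (W *\<^sub>R c)) \<bullet> v" by (simp add: linear_cmul[OF A(1)])
    thus ?thesis unfolding Wc by (simp add: linear_sum[OF A(1)] linear_cmul[OF A(1)] inner_sum_left)
  qed
  have Ad: "W * ((A *v u) \<bullet> d) = (\<Sum>t=1..k. w t * ((A *v u) \<bullet> y (t + 1)))"
  proof -
    have "W * ((A *v u) \<bullet> d) = (A *v u) \<bullet> (W *\<^sub>R d)" by simp
    thus ?thesis unfolding Wd by (simp add: inner_sum_right)
  qed
  have sum_const: "(\<Sum>t=1..k. w t * a) = W * a" for a by (simp only: sum_distrib_right[symmetric] W)
  have "(\<Sum>t=1..k. w t * gap t) = (\<Sum>t=1..k. w t * f (x (t + 1))) + W * ((A *v c) \<bullet> v) - W * G v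
      - W * f u - W * ((A *v u) \<bullet> d) + (\<Sum>t=1..k. w t * G (y (t + 1)))"
    unfolding gap_def Ac Ad sum_const[of "G v", symmetric] sum_const[of "f u", symmetric]
    by (simp add: algebra_simps sum.distrib sum_subtractf)
  with main fc W\<gamma> have "W * (f c + (A *v c) \<bullet> v - G v - (f u + (A *v u) \<bullet> d - \<gamma>))
      \<le> w 1 * (p 1 - \<mu>f) / 2 * (norm (x 1 - u))\<^sup>2 + w 1 / (2 * r 1) * (norm (y 1 - v))\<^sup>2"
    by (simp add: algebra_simps)
  also have "\<dots> = (s + 2) / 2 * ((norm (u - x 1))\<^sup>2 * (Lf - \<mu>f + 2 * \<tau> * M\<^sup>2) + (norm (v - y 1))\<^sup>2 / (2 * \<tau>))"
    using \<tau>(1) by (simp add: w_def p_def r_def norm_minus_commute field_simps)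
  finally have "f c + (A *v c) \<bullet> v - G v - (f u + (A *v u) \<bullet> d - \<gamma>)
      \<le> (s + 2) / 2 * ((norm (u - x 1))\<^sup>2 * (Lf - \<mu>f + 2 * \<tau> * M\<^sup>2) + (norm (v - y 1))\<^sup>2 / (2 * \<tau>)) / W"
    using W0 by (simp add: pos_le_divide_eq mult.commute)
  also have "\<dots> = (s + 2) / (real k * (real k + 3 + 2 * s)) *
      ((norm (u - x 1))\<^sup>2 * (Lf - \<mu>f + 2 * \<tau> * M\<^sup>2) + (norm (v - y 1))\<^sup>2 / (2 * \<tau>))"
    by (simp add: W_def)
  finally have "ereal (f c + (A *v c) \<bullet> v - G v - (f u + (A *v u) \<bullet> d - \<gamma>)) \<le> ereal \<dots>" by simp
  moreover have "E (k + 1) u v = ereal (f c + (A *v c) \<bullet> v - G v - (f u + (A *v u) \<bullet> d - \<gamma>))"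
    using \<gamma>(1) dom_fun_ereal[OF g(1) v] unfolding E[OF k] lagr_def c_def[symmetric] d_def[symmetric] G_def
    by (metis ereal_minus(1))
  ultimately show "E (k + 1) u v \<le> ereal ((of_int t0 + 2) / (real k * (real k + 3 + 2 * of_int t0)) *
      ((norm (u - x 1))\<^sup>2 * (Lf - \<mu>f + 2 * \<tau> * (opnorm A)\<^sup>2) + (norm (v - y 1))\<^sup>2 / (2 * \<tau>)))"
    by (simp add: s_def M_def)
qed

end
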